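(* Let $n$ be a positive integer. Every group of order $n$ is isomorphic to the cyclic group $\mathbb{Z}/n\mathbb{Z}$ if and only if $\gcd(n,\phi(n))=1$.
   Context: $\phi$ denotes the Euler totient function: $\phi(n)$ is the number of integers in $\{1,\dots,n\}$ that are relatively prime to $n$. *)

theory Defs
  imports "HOL-Algebra.Algebra" "HOL-Number_Theory.Totient"
begin

end

theory Submission
  imports Defs "HOL-Number_Theory.Pocklington"
begin

text \<open>A finite group is isomorphic to the integers modulo its order exactly when it is cyclic
(\<open>iso_integer_mod_group_iff_cyclic\<close>), so the question is for which \<open>n\<close> all groups of order \<open>n\<close> are
cyclic; such \<open>n\<close> are called cyclic numbers here.

Suppose \<open>gcd n (totient n) = 1\<close>; by induction, every proper divisor of \<open>n\<close> is a cyclic number, because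
coprimality passes to divisors. Let \<open>G\<close> be a non-cyclic group of order \<open>n\<close>.

First, the centre of \<open>G\<close> is trivial: otherwise it contains an element \<open>z\<close> of prime order \<open>p\<close>. The quotient
by the subgroup of \<open>z\<close> is cyclic by induction, so \<open>G\<close> has an element of order \<open>n div p\<close>. As \<open>n\<close> is
squarefree, this is coprime to \<open>p\<close>, and multiplying by \<open>z\<close> gives an element of order \<open>n\<close>
(\<open>cyclic_if_central_quotient_cyclic\<close>).

Hence the centralizer of every \<open>x \<noteq> 1\<close> is a proper subgroup, so it is cyclic, generated by
some \<open>a\<close>. It is also its own normalizer: an element \<open>g\<close> that normalizes it acts on it by
\<open>a \<mapsto> a ^ k\<close>, where the order of \<open>k\<close> as a unit modulo \<open>ord a\<close> divides both \<open>n\<close> and \<open>totient (ord a)\<close>,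
which are coprime. So \<open>k\<close> is 1 modulo \<open>ord a\<close>, and \<open>g\<close> commutes with \<open>a\<close>, hence with \<open>x\<close>
(\<open>commute_if_conj_eq_pow\<close>).

Finally, no group looks like this (\<open>centralizer_not_proper\<close>). The centralizers of non-identity elements
partition the non-identity elements of \<open>G\<close>. The conjugates of one centralizer \<open>A\<close> cover
\<open>n - n / card A\<close> of these, which is at least \<open>n / 2\<close> and less than \<open>n - 1\<close>. So there must be a second,
disjoint family of conjugate centralizers, again covering at least \<open>n / 2\<close>, and together they are too
many for the \<open>n - 1\<close> non-identity elements.

Conversely, suppose a prime \<open>p\<close> divides both \<open>n = p * m\<close> and \<open>totient n\<close>. If \<open>p\<close> divides \<open>m\<close>, the direct
product of cyclic groups of orders \<open>p\<close> and \<open>m\<close> is not cyclic, since its \<open>m\<close>-th powers are trivial. If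
not, \<open>p\<close> divides \<open>totient m\<close>, so there is a unit \<open>u\<close> of order \<open>p\<close> modulo \<open>m\<close>, and the semidirect
product of the integers modulo \<open>m\<close> with those modulo \<open>p\<close>, acting through \<open>u\<close>, is not even abelian.\<close>

section \<open>Cyclic groups and orders of elements\<close>

lemma (in group) finite_cyclic_group_iff_ord:
  assumes "finite (carrier G)"
  shows "cyclic_group G \<longleftrightarrow> (\<exists>x\<in>carrier G. ord x = order G)"
proof
  assume "cyclic_group G"
  then show "\<exists>x\<in>carrier G. ord x = order G"
    unfolding cyclic_group_def by (metis cyclic_order_is_ord)
next
  assume "\<exists>x\<in>carrier G. ord x = order G"
  then obtain x where x: "x \<in> carrier G" "ord x = order G" by blast
  have sub: "carrier (subgroup_generated G {x}) \<subseteq> carrier G"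
    by (simp add: carrier_subgroup_generated_subset)
  have "card (carrier (subgroup_generated G {x})) = card (carrier G)"
    using cyclic_order_is_ord[OF x(1)] x(2) by (simp add: order_def)
  then have "carrier (subgroup_generated G {x}) = carrier G"
    using card_subset_eq[OF assms sub] by blast
  then have "subgroup_generated G {x} = G"
    by (auto simp: subgroup_generated_def intro!: monoid.equality)
  then show "cyclic_group G"
    using x(1) unfolding cyclic_group_def by blast
qed

text \<open>Raising \<open>x \<otimes> y\<close> to its order times \<open>ord y\<close> eliminates \<open>y\<close>, so \<open>ord x\<close> divides that
exponent, and by coprimality it divides the order of \<open>x \<otimes> y\<close>; symmetrically for \<open>ord y\<close>.\<close>
lemma (in group) ord_mult_coprime:
  assumes xy: "x \<in> carrier G" "y \<in> carrier G" and comm: "x \<otimes> y = y \<otimes> x"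
    and cop: "coprime (ord x) (ord y)"
  shows "ord (x \<otimes> y) = ord x * ord y"
proof (rule dvd_antisym)
  show "ord (x \<otimes> y) dvd ord x * ord y"
    using ord_mul_divides comm xy by blast
  let ?d = "ord (x \<otimes> y)"
  have one: "x [^] (?d * k) \<otimes> y [^] (?d * k) = \<one>" for k
    using xy comm by (metis dvd_triv_left m_closed pow_eq_id pow_mult_distrib)
  have "ord x dvd ?d * ord y"
    using one[of "ord y"] xy by (simp add: pow_eq_id[symmetric] nat_pow_pow[symmetric])
      (metis dvd_triv_right nat_pow_closed nat_pow_pow pow_eq_id r_one)
  moreover have "ord y dvd ?d * ord x"
    using one[of "ord x"] xy by (simp add: pow_eq_id[symmetric] nat_pow_pow[symmetric])
      (metis dvd_triv_right nat_pow_closed nat_pow_pow pow_eq_id l_one)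
  ultimately show "ord x * ord y dvd ?d"
    using cop by (simp add: divides_mult coprime_dvd_mult_left_iff coprime_commute)
qed

lemma cyclic_integer_mod_group: "cyclic_group (integer_mod_group n)"
proof -
  interpret Z: group "integer_mod_group n" by simp
  show ?thesis
  proof (cases "n = 1")
    case True
    then show ?thesis
      by (simp add: trivial_imp_cyclic_group trivial_integer_mod_group)
  next
    case False
    have "carrier (integer_mod_group n) = range (\<lambda>k::int. 1 [^]\<^bsub>integer_mod_group n\<^esub> k)"
    proof (intro equalityI subsetI)
      fix k assume "k \<in> carrier (integer_mod_group n)"
      then have "k = 1 [^]\<^bsub>integer_mod_group n\<^esub> k"
        using False by (auto simp: int_pow_integer_mod_group carrier_integer_mod_group split: if_splits)
      then show "k \<in> range (\<lambda>k::int. 1 [^]\<^bsub>integer_mod_group n\<^esub> k)" by blast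
    next
      fix k assume "k \<in> range (\<lambda>k::int. 1 [^]\<^bsub>integer_mod_group n\<^esub> k)"
      then show "k \<in> carrier (integer_mod_group n)"
        using False Z.int_pow_closed[of 1] by auto
    qed
    then show ?thesis
      using False Z.cyclic_group by (metis integer_mod_group_1)
  qed
qed

lemma iso_integer_mod_group_iff_cyclic:
  fixes G :: "('a, 'b) monoid_scheme" (structure)
  assumes "group G" "order G = n" "n > 0"
  shows "G \<cong> integer_mod_group n \<longleftrightarrow> cyclic_group G"
proof
  interpret group G by fact
  assume "G \<cong> integer_mod_group n"
  then show "cyclic_group G"
    using isomorphic_group_cyclicity cyclic_integer_mod_group group_integer_mod_group assms(1) by blast
next
  interpret group G by fact
  have fin: "finite (carrier G)" using assms order_gt_0_iff_finite by auto
  assume "cyclic_group G"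
  then obtain x where x: "x \<in> carrier G" "ord x = n"
    using finite_cyclic_group_iff_ord fin assms(2) by auto
  define h where "h = (\<lambda>k::int. x [^] k)"
  have hom: "h \<in> hom (integer_mod_group n) G"
  proof (rule homI)
    show "h k \<in> carrier G" for k using x by (simp add: h_def)
    show "h (k \<otimes>\<^bsub>integer_mod_group n\<^esub> l) = h k \<otimes> h l" for k l
      using x by (simp add: h_def int_pow_mult[symmetric] int_pow_eq minus_mod_eq_mult_div
       mod_eq_dvd_iff[symmetric])
  qed
  have inj: "inj_on h (carrier (integer_mod_group n))"
    using x assms(3) unfolding h_def inj_on_def carrier_integer_mod_group
    by (auto simp: int_pow_eq mod_eq_dvd_iff[symmetric])
  have "h ` carrier (integer_mod_group n) \<subseteq> carrier G"
    using x by (auto simp: h_def)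
  moreover have "card (h ` carrier (integer_mod_group n)) = card (carrier G)"
    using inj assms by (simp add: card_image carrier_integer_mod_group order_def)
  ultimately have "h ` carrier (integer_mod_group n) = carrier G"
    using card_subset_eq fin by blast
  then have "h \<in> iso (integer_mod_group n) G"
    using hom inj by (simp add: iso_def bij_betw_def)
  then show "G \<cong> integer_mod_group n"
    using group.iso_sym[OF group_integer_mod_group] by (auto simp: is_iso_def)
qed

text \<open>An induction cannot range over groups of different element types, yet passing to a quotient turns
elements into sets. Copying every finite group to a set of naturals keeps the type fixed.\<close>
lemma finite_group_nat_copy:
  assumes "group G" "finite (carrier G)"
  obtains H :: "nat monoid" where "group H" "G \<cong> H"
proof -
  obtain f :: "'a \<Rightarrow> nat" where f: "inj_on f (carrier G)"
    using finite_imp_inj_to_nat_seg[OF assms(2)] by blast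
  then have iso: "f \<in> iso G (image_group f G)"
    by (rule inj_imp_image_group_iso)
  have "group (image_group f G)"
    using group.iso_imp_img_group[OF assms(1) iso] by (simp add: image_group_def)
  with iso show ?thesis
    using that by (auto simp: is_iso_def)
qed

section \<open>Automorphisms of a cyclic subgroup induced by conjugation\<close>

text \<open>The order of \<open>k\<close> modulo \<open>m\<close> divides \<open>n\<close> by hypothesis and \<open>totient m\<close> by Euler's theorem.\<close>
lemma cong_1_if_coprime_exponents:
  fixes k m n :: nat
  assumes "[k ^ n = 1] (mod m)" "n > 0" "coprime n (totient m)"
  shows "[k = 1] (mod m)"
proof -
  have "coprime (k ^ n) m"
    using assms(1) by (metis cong_imp_coprime cong_sym coprime_1_left)
  then have "coprime m k"
    using assms(2) by (simp add: coprime_commute)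
  then have "Pocklington.ord m k dvd totient m"
    by (rule order_divides_totient)
  moreover have "Pocklington.ord m k dvd n"
    using assms(1) ord_divides by blast
  ultimately have "Pocklington.ord m k dvd 1"
    using assms(3) by (metis coprime_common_divisor)
  then have "[k ^ 1 = 1] (mod m)"
    using ord_divides by blast
  then show ?thesis by simp
qed

lemma (in group) conj_nat_pow:
  fixes k :: nat
  assumes "x \<in> carrier G" "a \<in> carrier G"
  shows "(x \<otimes> a \<otimes> inv x) [^] k = x \<otimes> a [^] k \<otimes> inv x"
proof (induction k)
  case (Suc k)
  then have "(x \<otimes> a \<otimes> inv x) [^] Suc k = x \<otimes> a [^] k \<otimes> inv x \<otimes> (x \<otimes> a \<otimes> inv x)"
    by simp
  also have "\<dots> = x \<otimes> a [^] k \<otimes> (inv x \<otimes> (x \<otimes> (a \<otimes> inv x)))"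
    using assms by (simp add: m_assoc)
  also have "inv x \<otimes> (x \<otimes> (a \<otimes> inv x)) = a \<otimes> inv x"
    using assms by (simp flip: m_assoc)
  finally show ?case
    using assms by (simp add: m_assoc)
qed (use assms in simp)

text \<open>Conjugating \<open>order G\<close> times by \<open>g\<close> is trivial, and it raises \<open>a\<close> to the power \<open>k ^ order G\<close>. So
\<open>k\<close> is a unit modulo \<open>ord a\<close> whose order divides \<open>order G\<close>, and coprimality leaves only \<open>k \<equiv> 1\<close>.\<close>
lemma (in group) commute_if_conj_eq_pow:
  fixes k :: nat
  assumes fin: "finite (carrier G)" and ga: "g \<in> carrier G" "a \<in> carrier G"
    and conj: "g \<otimes> a \<otimes> inv g = a [^] k"
    and cop: "coprime (order G) (totient (ord a))"
  shows "g \<otimes> a = a \<otimes> g"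
proof -
  have iter: "g [^] j \<otimes> a \<otimes> inv (g [^] j) = a [^] (k ^ j)" for j :: nat
  proof (induction j)
    case (Suc j)
    have "g [^] Suc j \<otimes> a \<otimes> inv (g [^] Suc j) = g [^] j \<otimes> (g \<otimes> a \<otimes> inv g) \<otimes> inv (g [^] j)"
      using ga by (simp add: m_assoc inv_mult_group)
    also have "\<dots> = (g [^] j \<otimes> a \<otimes> inv (g [^] j)) [^] k"
      using ga by (simp add: conj conj_nat_pow)
    also have "\<dots> = a [^] (k ^ Suc j)"
      using ga by (simp add: Suc nat_pow_pow mult.commute)
    finally show ?case .
  qed (use ga in simp)
  have "a [^] int (k ^ order G) = a [^] int 1"
    unfolding int_pow_int using iter[of "order G"] ga by (simp add: pow_order_eq_1)
  then have "[k ^ order G = 1] (mod ord a)"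
    unfolding int_pow_eq[OF ga(2)] by (metis cong_iff_dvd_diff cong_int_iff cong_sym)
  then have "[k = 1] (mod ord a)"
    using cong_1_if_coprime_exponents cop fin order_gt_0_iff_finite by blast
  then have "a [^] int k = a [^] int 1"
    unfolding int_pow_eq[OF ga(2)] by (metis cong_iff_dvd_diff cong_int_iff cong_sym)
  then have "g \<otimes> a \<otimes> inv g = a"
    unfolding int_pow_int using conj ga by simp
  then show ?thesis
    using ga by (metis inv_solve_right m_closed)
qed

text \<open>A generator of the quotient lifts to an element \<open>y\<close> whose order is a multiple of the order \<open>m\<close> of the
quotient. A power \<open>w\<close> of \<open>y\<close> has order exactly \<open>m\<close>; it commutes with \<open>z\<close> and its order is coprime to that
of \<open>z\<close>, so \<open>z \<otimes> w\<close> generates \<open>G\<close>. The last assumption is conditional so that whoever applies the lemma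
may use that the quotient is a group and what its order is.\<close>
lemma (in group) cyclic_if_central_quotient_cyclic:
  assumes fin: "finite (carrier G)" and z: "z \<in> carrier G"
    and central: "\<And>g. g \<in> carrier G \<Longrightarrow> z \<otimes> g = g \<otimes> z"
    and cop: "coprime (ord z) (order G div ord z)"
    and cyc: "order (G Mod generate G {z}) = order G div ord z \<Longrightarrow>
      group (G Mod generate G {z}) \<Longrightarrow> cyclic_group (G Mod generate G {z})"
  shows "cyclic_group G"
proof -
  define N where "N = generate G {z}"
  have sub: "subgroup N G"
    unfolding N_def using z by (simp add: generate_is_subgroup)
  have "x \<otimes> h \<otimes> inv x \<in> N" if x: "x \<in> carrier G" and h: "h \<in> N" for x h
  proof -
    obtain k :: nat where k: "h = z [^] k"
      using h generate_pow_on_finite_carrier[OF fin z] by (auto simp: N_def)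
    have "x \<otimes> h = h \<otimes> x"
      unfolding k using group_commutes_pow[of z x k] central z x by simp
    then have "x \<otimes> h \<otimes> inv x = h"
      using z x k by (simp add: m_assoc)
    then show ?thesis using h by simp
  qed
  then interpret N: normal N G
    using sub normal_inv_iff by blast
  interpret Q: group "G Mod N" by (rule N.factorgroup_is_group)
  have "card N = ord z"
    unfolding N_def using generate_pow_card z by simp
  then have "order (G Mod N) * ord z = order G"
    using lagrange[OF sub] by (simp add: FactGroup_def order_def)
  moreover have "ord z > 0"
    using ord_ge_1[OF fin z] by simp
  ultimately have ordQ: "order (G Mod N) = order G div ord z"
    and ordG: "order G div ord z * ord z = order G"
    by (metis nonzero_mult_div_cancel_right less_numeral_extra(3))+
  define m where "m = order G div ord z"
  have finQ: "finite (carrier (G Mod N))"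
    using fin by (simp add: carrier_FactGroup)
  have "cyclic_group (G Mod N)"
    using cyc ordQ Q.is_group unfolding N_def by blast
  then obtain Y where Y: "Y \<in> carrier (G Mod N)" "Q.ord Y = m"
    using Q.finite_cyclic_group_iff_ord finQ ordQ m_def by auto
  then obtain y where y: "y \<in> carrier G" "Y = N #> y"
    by (auto simp: carrier_FactGroup)
  have "Y [^]\<^bsub>G Mod N\<^esub> ord y = \<one>\<^bsub>G Mod N\<^esub>"
    using y N.FactGroup_pow[of y "ord y"] coset_mult_one N.subset by simp
  then have "m dvd ord y"
    using Q.pow_eq_id Y by metis
  define w where "w = y [^] (ord y div m)"
  have "ord y > 0" using ord_ge_1[OF fin y(1)] by simp
  then have "ord w = m"
    unfolding w_def using \<open>m dvd ord y\<close> ord_pow[of y "ord y div m"] y(1)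
    by (auto elim!: dvdE)
  moreover have w: "w \<in> carrier G" using y by (simp add: w_def)
  ultimately have "ord (z \<otimes> w) = order G"
    using ord_mult_coprime[OF z w central[OF w]] cop ordG by (simp add: m_def mult.commute)
  then show ?thesis
    using finite_cyclic_group_iff_ord[OF fin] z w by blast
qed

section \<open>Numbers coprime to their totient\<close>

lemma coprime_totient_dvd:
  fixes d n :: nat
  assumes "coprime n (totient n)" "d dvd n"
  shows "coprime d (totient d)"
  using assms by (meson coprime_divisors totient_dvd)

text \<open>If \<open>p\<^sup>2\<close> divided \<open>n\<close>, then \<open>p\<close>, a factor of \<open>totient (p\<^sup>2) = p * (p - 1)\<close>, would divide \<open>totient n\<close>.\<close>
lemma coprime_totient_squarefree:
  fixes p n :: nat
  assumes "coprime n (totient n)" "Factorial_Ring.prime p" "p dvd n"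
  shows "coprime p (n div p)"
proof (rule prime_imp_coprime[OF assms(2)])
  show "\<not> p dvd n div p"
  proof
    assume "p dvd n div p"
    then have "p ^ 2 dvd n"
      using assms(3) by (metis dvd_mult_div_cancel mult_dvd_mono dvd_refl power2_eq_square)
    then have "totient (p ^ 2) dvd totient n"
      by (rule totient_dvd)
    moreover have "p dvd totient (p ^ 2)"
      using assms(2) by (simp add: totient_prime_power)
    ultimately have "p dvd totient n" by (rule dvd_trans[rotated])
    then have "p dvd 1"
      using assms coprime_common_divisor by blast
    then show False using assms(2) by simp
  qed
qed

section \<open>Groups with abelian self-normalizing centralizers\<close>

definition (in group) centralizer :: "'a \<Rightarrow> 'a set"
  where "centralizer x = {g \<in> carrier G. g \<otimes> x = x \<otimes> g}"

lemma (in group) subgroup_centralizer: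
  assumes x: "x \<in> carrier G"
  shows "subgroup (centralizer x) G"
proof (rule subgroupI)
  show "centralizer x \<noteq> {}" using x by (auto simp: centralizer_def)
next
  fix g assume "g \<in> centralizer x"
  then show "inv g \<in> centralizer x"
    using x by (simp add: centralizer_def)
      (metis inv_closed inv_solve_left inv_solve_right m_assoc m_closed)
next
  fix g h assume "g \<in> centralizer x" "h \<in> centralizer x"
  then show "g \<otimes> h \<in> centralizer x"
    using x by (simp add: centralizer_def) (metis m_assoc)
qed (auto simp: centralizer_def)

lemma (in group) conj_in_centralizer_conj_iff:
  assumes "g \<in> carrier G" "x \<in> carrier G" "y \<in> carrier G"
  shows "g \<otimes> y \<otimes> inv g \<in> centralizer (g \<otimes> x \<otimes> inv g) \<longleftrightarrow> y \<in> centralizer x"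
proof -
  have mult: "(g \<otimes> a \<otimes> inv g) \<otimes> (g \<otimes> b \<otimes> inv g) = g \<otimes> (a \<otimes> b) \<otimes> inv g"
    if "a \<in> carrier G" "b \<in> carrier G" for a b
    using that assms(1) by (metis (no_types, lifting) inv_closed inv_solve_right m_assoc m_closed)
  show ?thesis
    using assms by (simp add: centralizer_def mult)
qed

lemma (in group) conj_cancel:
  assumes "g \<in> carrier G" "x \<in> carrier G"
  shows "inv g \<otimes> (g \<otimes> x \<otimes> inv g) \<otimes> g = x" "g \<otimes> (inv g \<otimes> x \<otimes> g) \<otimes> inv g = x"
  using assms by (simp_all add: m_assoc inv_solve_left)
    (metis assms inv_solve_left m_closed inv_closed)+

text \<open>The inclusion in the last assumption says that \<open>g\<close> normalizes the centralizer of \<open>x\<close>: in a finite group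
a conjugate of a subgroup contained in it is equal to it. A minimal non-cyclic group of order coprime to
its totient would satisfy these assumptions with all centralizers of non-identity elements proper; the
aim of this section is to exclude that by counting.\<close>
locale selfnormalizing_centralizers = group +
  assumes finite_carrier: "finite (carrier G)"
    and centralizer_comm:
      "\<lbrakk>x \<in> carrier G; x \<noteq> \<one>; y \<in> centralizer x; z \<in> centralizer x\<rbrakk> \<Longrightarrow> y \<otimes> z = z \<otimes> y"
    and centralizer_selfnormalizing:
      "\<lbrakk>x \<in> carrier G; x \<noteq> \<one>; g \<in> carrier G; (\<lambda>a. g \<otimes> a \<otimes> inv g) ` centralizer x \<subseteq> centralizer x\<rbrakk>
        \<Longrightarrow> g \<in> centralizer x"
begin

text \<open>Centralizers being abelian, commutation is transitive on the non-identity elements, so the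
centralizers partition them.\<close>
lemma centralizer_eq:
  assumes "x \<in> carrier G" "x \<noteq> \<one>" "y \<in> centralizer x" "y \<noteq> \<one>"
  shows "centralizer y = centralizer x"
proof -
  have le: "centralizer x \<subseteq> centralizer y"
    if "x \<in> carrier G" "x \<noteq> \<one>" "y \<in> centralizer x" for x y
    using centralizer_comm[OF that(1,2) _ that(3)] by (auto simp: centralizer_def)
  have "y \<in> carrier G" "x \<in> centralizer y"
    using assms by (auto simp: centralizer_def)
  with assms le show ?thesis by blast
qed

text \<open>The non-identity part of the union of all conjugates of the centralizer of \<open>x\<close>, written as the image
of the conjugation map on pairs because its size is found by counting the fibres of that map.\<close>
definition conj_union :: "'a \<Rightarrow> 'a set" where
  "conj_union x = (\<lambda>(g, a). g \<otimes> a \<otimes> inv g) ` (carrier G \<times> (centralizer x - {\<one>}))"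

lemma conj_union_subset: "conj_union x \<subseteq> carrier G - {\<one>}"
proof -
  have "g \<otimes> a \<otimes> inv g \<noteq> \<one>" if "g \<in> carrier G" "a \<in> carrier G" "a \<noteq> \<one>" for g a
    using conj_cancel(1)[OF that(1,2)] that by auto
  then show ?thesis
    by (auto simp: conj_union_def centralizer_def)
qed

text \<open>If \<open>(g, a)\<close> and \<open>(h, b)\<close> have the same image, then \<open>c = inv h \<otimes> g\<close> conjugates \<open>a\<close> to \<open>b\<close>, hence
the centralizer of \<open>a\<close> to that of \<open>b\<close>. Both equal the centralizer of \<open>x\<close>, so \<open>c\<close> normalizes it,
belongs to it, and therefore commutes with \<open>a\<close>; this forces \<open>a = b\<close>.\<close>
lemma conj_fibre:
  assumes x: "x \<in> carrier G" "x \<noteq> \<one>" and h: "h \<in> carrier G" and b: "b \<in> centralizer x" "b \<noteq> \<one>"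
  shows "{p \<in> carrier G \<times> (centralizer x - {\<one>}). (\<lambda>(g, a). g \<otimes> a \<otimes> inv g) p = h \<otimes> b \<otimes> inv h}
    = (\<lambda>c. (h \<otimes> c, b)) ` centralizer x" (is "?L = ?R")
proof
  interpret C: subgroup "centralizer x" G by (rule subgroup_centralizer[OF x(1)])
  show "?R \<subseteq> ?L"
  proof
    fix q assume "q \<in> ?R"
    then obtain c where c: "c \<in> centralizer x" and q: "q = (h \<otimes> c, b)" by blast
    have bG: "b \<in> carrier G" and cG: "c \<in> carrier G" using b c by auto
    have "c \<otimes> b \<otimes> inv c = b"
      using centralizer_comm[OF x c b(1)] bG cG by (simp add: inv_solve_right m_assoc)
    have "h \<otimes> c \<otimes> b \<otimes> inv (h \<otimes> c) = h \<otimes> (c \<otimes> b \<otimes> inv c) \<otimes> inv h"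
      using h bG cG by (simp add: inv_mult_group m_assoc)
    then show "q \<in> ?L"
      using \<open>c \<otimes> b \<otimes> inv c = b\<close> h b cG by (simp add: q)
  qed
  show "?L \<subseteq> ?R"
  proof
    fix q assume "q \<in> ?L"
    then obtain g a where q: "q = (g, a)" and g: "g \<in> carrier G"
      and a: "a \<in> centralizer x" "a \<noteq> \<one>" and eq: "g \<otimes> a \<otimes> inv g = h \<otimes> b \<otimes> inv h"
      by auto
    define c where "c = inv h \<otimes> g"
    have aG: "a \<in> carrier G" and bG: "b \<in> carrier G" and cG: "c \<in> carrier G"
      using a b g h by (auto simp: c_def)
    have g_eq: "g = h \<otimes> c"
      using g h by (simp add: c_def m_assoc[symmetric])
    have "c \<otimes> a \<otimes> inv c = inv h \<otimes> (g \<otimes> a \<otimes> inv g) \<otimes> h"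
      using g h aG by (simp add: c_def inv_mult_group m_assoc)
    then have cb: "c \<otimes> a \<otimes> inv c = b"
      using conj_cancel(1)[OF h bG] eq by simp
    have "(\<lambda>d. c \<otimes> d \<otimes> inv c) ` centralizer x \<subseteq> centralizer x"
    proof clarify
      fix d assume d: "d \<in> centralizer x"
      then have "d \<in> centralizer a"
        using centralizer_eq[OF x a] by simp
      then have "c \<otimes> d \<otimes> inv c \<in> centralizer b"
        using conj_in_centralizer_conj_iff[OF cG aG, of d] d cb by auto
      then show "c \<otimes> d \<otimes> inv c \<in> centralizer x"
        using centralizer_eq[OF x b] by simp
    qed
    then have c: "c \<in> centralizer x"
      by (rule centralizer_selfnormalizing[OF x cG])
    then have "a = b"
      using centralizer_comm[OF x c a(1)] cb aG cG by (simp add: inv_solve_right' m_assoc)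
    with g_eq c q show "q \<in> ?R" by blast
  qed
qed

lemma card_conj_union:
  assumes x: "x \<in> carrier G" "x \<noteq> \<one>"
  shows "card (conj_union x) * card (centralizer x) = order G * (card (centralizer x) - 1)"
proof -
  interpret C: subgroup "centralizer x" G by (rule subgroup_centralizer[OF x(1)])
  let ?f = "\<lambda>(g, a). g \<otimes> a \<otimes> inv g" and ?S = "carrier G \<times> (centralizer x - {\<one>})"
  have finC: "finite (centralizer x)"
    using finite_carrier C.subset finite_subset by blast
  have fibre: "card {p \<in> ?S. ?f p = u} = card (centralizer x)" if u: "u \<in> conj_union x" for u
  proof -
    obtain h b where hb: "h \<in> carrier G" "b \<in> centralizer x" "b \<noteq> \<one>" "u = h \<otimes> b \<otimes> inv h"
      using u by (auto simp: conj_union_def)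
    have "inj_on (\<lambda>c. (h \<otimes> c, b)) (centralizer x)"
      using hb(1) C.mem_carrier by (auto simp: inj_on_def)
    then show ?thesis
      unfolding hb(4) conj_fibre[OF x hb(1-3)] by (rule card_image)
  qed
  have "card ?S = (\<Sum>p\<in>?S. 1)" by simp
  also have "\<dots> = (\<Sum>u\<in>conj_union x. of_nat (card {p \<in> ?S. ?f p = u}) * 1)"
    by (rule sum_fun_comp) (use finite_carrier finC in \<open>auto simp: conj_union_def\<close>)
  also have "\<dots> = card (conj_union x) * card (centralizer x)"
    using fibre by simp
  finally show ?thesis
    using finC by (simp add: card_cartesian_product order_def)
qed

text \<open>A common element of the two unions makes a conjugate of the centralizer of \<open>x\<close> equal to the
centralizer of \<open>y\<close>, and the latter contains \<open>y\<close>.\<close>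
lemma conj_union_disjoint:
  assumes x: "x \<in> carrier G" "x \<noteq> \<one>" and y: "y \<in> carrier G" "y \<noteq> \<one>" and "y \<notin> conj_union x"
  shows "conj_union x \<inter> conj_union y = {}"
proof (rule ccontr)
  assume "conj_union x \<inter> conj_union y \<noteq> {}"
  then obtain g a h b where ga: "g \<in> carrier G" "a \<in> centralizer x" "a \<noteq> \<one>"
    and hb: "h \<in> carrier G" "b \<in> centralizer y" "b \<noteq> \<one>"
    and eq: "g \<otimes> a \<otimes> inv g = h \<otimes> b \<otimes> inv h"
    by (auto simp: conj_union_def) 
  have aG: "a \<in> carrier G" and bG: "b \<in> carrier G"
    using ga hb by (auto simp: centralizer_def)
  define c where "c = inv h \<otimes> g"
  have cG: "c \<in> carrier G" using ga hb by (simp add: c_def)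
  have "c \<otimes> a \<otimes> inv c = inv h \<otimes> (g \<otimes> a \<otimes> inv g) \<otimes> h"
    using ga hb aG by (simp add: c_def inv_mult_group m_assoc)
  then have cb: "c \<otimes> a \<otimes> inv c = b"
    using conj_cancel(1)[OF hb(1) bG] eq by simp
  define d where "d = inv c \<otimes> y \<otimes> c"
  have dG: "d \<in> carrier G" using cG y by (simp add: d_def)
  have yd: "c \<otimes> d \<otimes> inv c = y"
    unfolding d_def by (rule conj_cancel(2)[OF cG y(1)])
  have "y \<in> centralizer b"
    using centralizer_eq[OF y hb(2,3)] y by (simp add: centralizer_def)
  then have "d \<in> centralizer a"
    using conj_in_centralizer_conj_iff[OF cG aG dG] cb yd by simp
  then have "d \<in> centralizer x"
    using centralizer_eq[OF x ga(2,3)] by simp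
  moreover have "d \<noteq> \<one>" using yd cG y by auto
  ultimately have "y \<in> conj_union x"
    unfolding conj_union_def using cG yd by force
  with assms show False by blast
qed

text \<open>If all these centralizers were proper, each \<open>conj_union x\<close> would contain at least half as many elements as
\<open>G\<close>, but not all non-identity elements. A missed element \<open>y\<close> gives a second union disjoint from the
first, so that there would be at least \<open>order G\<close> non-identity elements.\<close>
theorem centralizer_not_proper:
  assumes "order G \<noteq> 1"
  shows "\<exists>x \<in> carrier G. x \<noteq> \<one> \<and> centralizer x = carrier G"
proof (rule ccontr)
  assume no: "\<not> ?thesis"
  have card2: "2 \<le> card (centralizer x)" "card (centralizer x) < order G"
    if x: "x \<in> carrier G" "x \<noteq> \<one>" for x
  proof -
    have sub: "centralizer x \<subseteq> carrier G" by (auto simp: centralizer_def)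
    have "{\<one>, x} \<subseteq> centralizer x" using x by (auto simp: centralizer_def)
    then have "card {\<one>, x} \<le> card (centralizer x)"
      by (rule card_mono[rotated]) (use sub finite_carrier finite_subset in blast)
    then show "2 \<le> card (centralizer x)" using x by simp
    show "card (centralizer x) < order G"
      unfolding order_def using no x sub finite_carrier by (metis psubsetI psubset_card_mono)
  qed
  \<comment> \<open>from \<open>card (conj_union x) = n - n / c\<close> with \<open>n = order G\<close> and \<open>c\<close>, the size of the centralizer, at least 2\<close>
  have half: "order G \<le> 2 * card (conj_union x)" if x: "x \<in> carrier G" "x \<noteq> \<one>" for x
  proof -
    obtain k where k: "card (centralizer x) = k + 2"
      using card2(1)[OF x] by (metis add.commute le_Suc_ex)
    have "order G * (k + 2) \<le> order G * (2 * (k + 1))" by simp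
    also have "\<dots> = 2 * card (conj_union x) * (k + 2)"
      using card_conj_union[OF x] by (simp add: k)
    finally have "order G * (k + 2) \<le> 2 * card (conj_union x) * (k + 2)" .
    then show ?thesis by (simp only: mult_le_cancel2)
  qed
  have card_minus: "card (carrier G - {\<one>}) = order G - 1"
    using finite_carrier by (simp add: order_def)
  have pos: "order G > 0" using finite_carrier order_gt_0_iff_finite by blast
  have "carrier G \<noteq> {\<one>}"
    using assms by (auto simp: order_def)
  then obtain x where x: "x \<in> carrier G" "x \<noteq> \<one>"
    using one_closed by blast
  \<comment> \<open>from the same formula, because \<open>c < n\<close> gives \<open>n / c > 1\<close>\<close>
  have "card (conj_union x) < order G - 1"
  proof -
    obtain k where k: "card (centralizer x) = k + 2"
      using card2(1)[OF x] by (metis add.commute le_Suc_ex)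
    obtain l where l: "order G = l + k + 3"
    proof
      show "order G = (order G - (k + 3)) + k + 3"
        using card2(2)[OF x] k by simp
    qed
    have "order G * (k + 1) < (order G - 1) * (k + 2)"
      unfolding l by (simp add: algebra_simps)
    then have "card (conj_union x) * (k + 2) < (order G - 1) * (k + 2)"
      using card_conj_union[OF x] by (simp add: k)
    then show ?thesis by (simp only: mult_less_cancel2)
  qed
  then have "conj_union x \<noteq> carrier G - {\<one>}"
    using card_minus by (metis less_irrefl)
  then obtain y where y: "y \<in> carrier G" "y \<noteq> \<one>" "y \<notin> conj_union x"
    using conj_union_subset by blast
  have "card (conj_union x \<union> conj_union y) = card (conj_union x) + card (conj_union y)"
    using conj_union_disjoint[OF x y] conj_union_subset finite_carrier
    by (meson card_Un_disjoint finite_Diff finite_subset)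
  moreover have "card (conj_union x \<union> conj_union y) \<le> order G - 1"
    unfolding card_minus[symmetric]
    by (intro card_mono Un_least conj_union_subset) (use finite_carrier in simp)
  ultimately show False
    using half[OF x] half[OF y(1,2)] pos by linarith
qed

end

section \<open>Numbers coprime to their totient are cyclic numbers\<close>

text \<open>Quantifying over groups on the naturals loses nothing: \<open>cyclic_number_imp_cyclic_group\<close> below extends
the conclusion to groups over any type.\<close>
definition cyclic_number :: "nat \<Rightarrow> bool" where
  "cyclic_number n \<longleftrightarrow> (\<forall>G :: nat monoid. group G \<and> order G = n \<longrightarrow> cyclic_group G)"

lemma order_iso: "G \<cong> H \<Longrightarrow> order G = order H"
  by (simp add: order_def iso_same_card)

lemma cyclic_number_imp_cyclic_group:
  assumes "cyclic_number n" "n > 0" "group G" "order G = n"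
  shows "cyclic_group G"
proof -
  have "finite (carrier G)"
    using assms monoid.order_gt_0_iff_finite group.is_monoid by metis
  then obtain H :: "nat monoid" where H: "group H" "G \<cong> H"
    using finite_group_nat_copy assms(3) by blast
  then have "cyclic_group H"
    using assms order_iso unfolding cyclic_number_def by metis
  then show ?thesis
    using isomorphic_group_cyclicity H assms(3) by blast
qed

text \<open>The inductive step: if \<open>G\<close> were not cyclic, its centre would be trivial and its centralizers of
non-identity elements would be proper, cyclic and self-normalizing, against the counting argument.\<close>
lemma (in group) cyclic_group_step:
  assumes fin: "finite (carrier G)" and cop: "coprime (order G) (totient (order G))"
    and IH: "\<And>d. \<lbrakk>d dvd order G; d < order G\<rbrakk> \<Longrightarrow> cyclic_number d"
  shows "cyclic_group G"
proof (rule ccontr)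
  have pos: "order G > 0" using fin order_gt_0_iff_finite by blast
  assume noncyc: "\<not> cyclic_group G"
  have trivial_centre: "z = \<one>"
    if z: "z \<in> carrier G" and central: "\<And>g. g \<in> carrier G \<Longrightarrow> z \<otimes> g = g \<otimes> z" for z
  proof (rule ccontr)
    assume "z \<noteq> \<one>"
    then have "ord z \<noteq> 1" using ord_eq_1 z by blast
    then obtain p where p: "Factorial_Ring.prime p" "p dvd ord z"
      using prime_factor_nat by blast
    \<comment> \<open>a central element of prime order\<close>
    define w where "w = z [^] (ord z div p)"
    have ordz: "ord z > 0" using ord_ge_1[OF fin z] by simp
    have w: "w \<in> carrier G" using z by (simp add: w_def)
    have ordw: "ord w = p"
      unfolding w_def using p ordz ord_pow[of z "ord z div p"] z by (auto elim!: dvdE)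
    have "p dvd order G"
      using p ord_dvd_group_order z dvd_trans by metis
    have w_central: "w \<otimes> g = g \<otimes> w" if "g \<in> carrier G" for g
      unfolding w_def using group_commutes_pow central z that by simp
    have "order G div p < order G" "order G div p > 0" "order G div p dvd order G"
      using p pos \<open>p dvd order G\<close> prime_gt_1_nat[of p] by (auto elim!: dvdE)
    note quot = this
    have "cyclic_group G"
    proof (rule cyclic_if_central_quotient_cyclic[OF fin w w_central])
      show "coprime (ord w) (order G div ord w)"
        unfolding ordw by (rule coprime_totient_squarefree[OF cop p(1) \<open>p dvd order G\<close>])
    next
      assume "order (G Mod generate G {w}) = order G div ord w" "group (G Mod generate G {w})"
      then show "cyclic_group (G Mod generate G {w})"
        using cyclic_number_imp_cyclic_group[OF IH[OF quot(3,1)] quot(2)] unfolding ordw by blast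
    qed
    with noncyc show False by blast
  qed
  have full_centralizer: "z = \<one>" if "z \<in> carrier G" "centralizer z = carrier G" for z
  proof (rule trivial_centre[OF that(1)])
    fix g assume "g \<in> carrier G"
    then have "g \<in> centralizer z" using that(2) by simp
    then show "z \<otimes> g = g \<otimes> z" by (simp add: centralizer_def)
  qed
  have cyc_centralizer: "\<exists>a \<in> centralizer x. centralizer x = {a [^] k | k :: nat. True}"
    if x: "x \<in> carrier G" "x \<noteq> \<one>" for x
  proof -
    interpret C: subgroup "centralizer x" G by (rule subgroup_centralizer[OF x(1)])
    interpret CG: group "G\<lparr>carrier := centralizer x\<rparr>" by (rule C.subgroup_is_group[OF is_group])
    have finC: "finite (centralizer x)" using fin C.subset finite_subset by blast
    have "centralizer x \<noteq> carrier G"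
      using full_centralizer x by blast
    then have "card (centralizer x) < order G"
      using C.subset fin by (metis order_def psubsetI psubset_card_mono)
    moreover have "card (centralizer x) dvd order G"
      using lagrange[OF C.subgroup_axioms] by (metis dvd_triv_right)
    moreover have "card (centralizer x) > 0"
      using finC C.one_closed card_gt_0_iff by blast
    ultimately have "cyclic_group (G\<lparr>carrier := centralizer x\<rparr>)"
      by (intro cyclic_number_imp_cyclic_group[OF IH _ CG.is_group]) (auto simp: order_def)
    then obtain a where a: "a \<in> centralizer x"
      "subgroup_generated (G\<lparr>carrier := centralizer x\<rparr>) {a} = G\<lparr>carrier := centralizer x\<rparr>"
      by (auto simp: cyclic_group_def)
    have "centralizer x = carrier (subgroup_generated (G\<lparr>carrier := centralizer x\<rparr>) {a})"
      unfolding a(2) by simp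
    also have "\<dots> = {a [^]\<^bsub>G\<lparr>carrier := centralizer x\<rparr>\<^esub> k | k :: nat. True}"
      using a(1) CG.generate_pow_on_finite_carrier[of a] finC
      by (simp add: carrier_subgroup_generated)
    also have "\<dots> = {a [^] k | k :: nat. True}"
      by (simp add: nat_pow_consistent[symmetric])
    finally show ?thesis using a(1) by blast
  qed
  interpret selfnormalizing_centralizers G
  proof
    show "finite (carrier G)" by (rule fin)
  next
    fix x y z
    assume x: "x \<in> carrier G" "x \<noteq> \<one>" and yz: "y \<in> centralizer x" "z \<in> centralizer x"
    obtain a where a: "a \<in> centralizer x" "centralizer x = {a [^] k | k :: nat. True}"
      using cyc_centralizer[OF x] by blast
    then have aG: "a \<in> carrier G" by (simp add: centralizer_def)
    obtain k l :: nat where "y = a [^] k" "z = a [^] l"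
      using yz a(2) by blast
    then show "y \<otimes> z = z \<otimes> y"
      using aG by (simp add: nat_pow_mult add.commute)
  next
    fix x g
    assume x: "x \<in> carrier G" "x \<noteq> \<one>" and g: "g \<in> carrier G"
      and norm: "(\<lambda>a. g \<otimes> a \<otimes> inv g) ` centralizer x \<subseteq> centralizer x"
    obtain a where a: "a \<in> centralizer x" "centralizer x = {a [^] k | k :: nat. True}"
      using cyc_centralizer[OF x] by blast
    then have aG: "a \<in> carrier G" by (simp add: centralizer_def)
    have "g \<otimes> a \<otimes> inv g \<in> centralizer x" using norm a(1) by blast
    then obtain k :: nat where k: "g \<otimes> a \<otimes> inv g = a [^] k"
      using a(2) by blast
    have "coprime (order G) (totient (ord a))"
      using cop ord_dvd_group_order[OF aG] totient_dvd
      by (metis coprime_divisors dvd_refl)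
    then have ga: "a \<otimes> g = g \<otimes> a"
      using commute_if_conj_eq_pow[OF fin g aG k] by simp
    have "x \<in> centralizer x" using x by (simp add: centralizer_def)
    then obtain l :: nat where "x = a [^] l" using a(2) by blast
    then have "x \<otimes> g = g \<otimes> x"
      using group_commutes_pow[OF ga aG g] by simp
    then show "g \<in> centralizer x" using g by (simp add: centralizer_def)
  qed
  have "order G \<noteq> 1"
  proof
    assume "order G = 1"
    then have "\<exists>x\<in>carrier G. ord x = order G"
      using ord_id one_closed by metis
    with noncyc finite_cyclic_group_iff_ord[OF fin] show False by blast
  qed
  then obtain x where "x \<in> carrier G" "x \<noteq> \<one>" "centralizer x = carrier G"
    using centralizer_not_proper by blast
  then show False
    using full_centralizer by blast
qed

lemma cyclic_number_if_coprime_totient: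
  assumes "n > 0" "coprime n (totient n)"
  shows "cyclic_number n"
  using assms
proof (induction n rule: less_induct)
  case (less n)
  have IH: "cyclic_number d" if "d dvd n" "d < n" for d
    using less.IH[OF that(2) dvd_pos_nat[OF less.prems(1) that(1)]
        coprime_totient_dvd[OF less.prems(2) that(1)]] .
  show ?case
    unfolding cyclic_number_def
  proof (intro allI impI, elim conjE)
    fix G :: "nat monoid"
    assume "group G" and "order G = n"
    show "cyclic_group G"
    proof (rule group.cyclic_group_step[OF \<open>group G\<close>], unfold \<open>order G = n\<close>)
      show "finite (carrier G)"
        using less.prems(1) monoid.order_gt_0_iff_finite[OF group.is_monoid[OF \<open>group G\<close>]]
        unfolding \<open>order G = n\<close> by blast
    qed (fact less.prems(2), fact IH)
  qed
qed

section \<open>Non-cyclic groups when the order shares a factor with its totient\<close>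

lemma nat_pow_DirProd:
  fixes k :: nat
  shows "(x, y) [^]\<^bsub>G \<times>\<times> H\<^esub> k = (x [^]\<^bsub>G\<^esub> k, y [^]\<^bsub>H\<^esub> k)"
  by (induction k) (simp_all add: nat_pow_def)

text \<open>Every element of the product becomes trivial when raised to the power \<open>order H\<close>.\<close>
lemma DirProd_not_cyclic:
  fixes G :: "('a, 'c) monoid_scheme" and H :: "('b, 'd) monoid_scheme"
  assumes "group G" "group H" "order G > 1" "order H > 0" "order G dvd order H"
  shows "\<not> cyclic_group (G \<times>\<times> H)"
proof
  interpret G: group G by fact
  interpret H: group H by fact
  interpret P: group "G \<times>\<times> H" using assms by (simp add: DirProd_group)
  assume "cyclic_group (G \<times>\<times> H)"
  moreover have "finite (carrier (G \<times>\<times> H))"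
    using assms G.order_gt_0_iff_finite H.order_gt_0_iff_finite by simp
  ultimately obtain x y where xy: "(x, y) \<in> carrier (G \<times>\<times> H)" "P.ord (x, y) = order (G \<times>\<times> H)"
    using P.finite_cyclic_group_iff_ord by (metis surj_pair)
  have "x [^]\<^bsub>G\<^esub> order H = \<one>\<^bsub>G\<^esub>"
    using xy assms(5) G.pow_order_eq_1 G.pow_eq_id G.ord_dvd_group_order
    by (auto intro: dvd_trans)
  then have "(x, y) [^]\<^bsub>G \<times>\<times> H\<^esub> order H = \<one>\<^bsub>G \<times>\<times> H\<^esub>"
    using xy H.pow_order_eq_1 by (simp add: nat_pow_DirProd)
  then have "order (G \<times>\<times> H) dvd order H"
    using P.pow_eq_id[OF xy(1)] xy(2) by simp
  then have "order G * order H \<le> order H"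
    using assms(4) by (auto simp: order_def card_cartesian_product intro: dvd_imp_le)
  then show False using assms(3,4) by simp
qed

text \<open>The semidirect product of the integers modulo \<open>m\<close> by those modulo \<open>p\<close>, where \<open>i\<close> acts as
multiplication by \<open>u ^ i\<close>. The action is well defined only if \<open>u ^ p\<close> is 1 modulo \<open>m\<close>.\<close>
definition twisted_product :: "nat \<Rightarrow> nat \<Rightarrow> nat \<Rightarrow> (nat \<times> nat) monoid" where
  "twisted_product m p u =
    \<lparr>carrier = {..<m} \<times> {..<p},
     monoid.mult = (\<lambda>(a, i) (b, j). ((a + u ^ i * b) mod m, (i + j) mod p)),
     one = (0, 0)\<rparr>"

lemma order_twisted_product: "order (twisted_product m p u) = m * p"
  by (simp add: order_def twisted_product_def card_cartesian_product)

lemma group_twisted_product: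
  fixes m p u :: nat
  assumes "m > 0" "p > 0" and root: "[u ^ p = 1] (mod m)"
  shows "group (twisted_product m p u)"
proof -
  have red: "[u ^ (k mod p) = u ^ k] (mod m)" for k
  proof -
    have "[u ^ (k mod p) * (u ^ p) ^ (k div p) = u ^ (k mod p) * 1 ^ (k div p)] (mod m)"
      by (intro cong_mult cong_pow cong_refl root)
    moreover have "u ^ (k mod p) * (u ^ p) ^ (k div p) = u ^ k"
      by (simp flip: power_mult power_add)
    ultimately show ?thesis by (simp add: cong_sym)
  qed
  show ?thesis
  proof (rule groupI, goal_cases)
    case (3 x y z)
    obtain a i b j c k where xyz: "x = (a, i)" "y = (b, j)" "z = (c, k)"
      by (metis surj_pair)
    have "[(a + u ^ i * b) mod m + u ^ ((i + j) mod p) * c = (a + u ^ i * b) + u ^ (i + j) * c] (mod m)"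
      by (intro cong_add cong_mult red cong_refl) (simp add: cong_def)
    also have "(a + u ^ i * b) + u ^ (i + j) * c = a + u ^ i * (b + u ^ j * c)"
      by (simp add: algebra_simps power_add)
    also have "[\<dots> = a + u ^ i * ((b + u ^ j * c) mod m)] (mod m)"
      by (intro cong_add cong_mult cong_refl) (simp add: cong_def)
    finally show ?case
      by (simp add: xyz twisted_product_def cong_def mod_add_left_eq mod_add_right_eq add.assoc)
  next
    case (5 x)
    then obtain a i where x: "x = (a, i)" "a < m" "i < p"
      by (auto simp: twisted_product_def)
    define j where "j = (p - i) mod p"
    define b where "b = (m - u ^ j * a mod m) mod m"
    have "(b + u ^ j * a) mod m = (m - u ^ j * a mod m + u ^ j * a mod m) mod m"
      unfolding b_def by (metis mod_add_left_eq mod_add_right_eq)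
    also have "\<dots> = 0"
      using assms(1) by (simp add: mod_less_divisor less_imp_le)
    finally have "(b + u ^ j * a) mod m = 0" .
    moreover have "(j + i) mod p = 0"
      using x by (simp add: j_def mod_add_left_eq)
    ultimately show ?case
      using assms by (intro bexI[of _ "(b, j)"]) (auto simp: x twisted_product_def b_def j_def)
  qed (use assms in \<open>auto simp: twisted_product_def\<close>)
qed

text \<open>The product of \<open>(0, 1)\<close> and \<open>(1, 0)\<close> has first component \<open>u\<close> modulo \<open>m\<close> in one order and 1 in the
other, so the group is not abelian.\<close>
lemma twisted_product_not_cyclic:
  fixes m p u :: nat
  assumes "m > 0" "p > 0" "[u ^ p = 1] (mod m)" "\<not> [u = 1] (mod m)"
  shows "\<not> cyclic_group (twisted_product m p u)"
proof
  interpret T: group "twisted_product m p u"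
    using group_twisted_product assms by blast
  assume "cyclic_group (twisted_product m p u)"
  then interpret T: comm_group "twisted_product m p u"
    by (rule T.cyclic_imp_abelian_group)
  have m: "m \<noteq> 1" and p: "p \<noteq> 1"
    using assms by auto
  then have "(0, 1) \<otimes>\<^bsub>twisted_product m p u\<^esub> (1, 0) = (1, 0) \<otimes>\<^bsub>twisted_product m p u\<^esub> (0, 1)"
    using assms(1,2) by (intro T.m_comm) (auto simp: twisted_product_def)
  then show False
    using m p assms by (simp add: twisted_product_def cong_def)
qed

text \<open>Sylow's theorem gives a subgroup of order \<open>p\<close> in the group of units modulo \<open>m\<close>, which has order
\<open>totient m\<close>.\<close>
lemma ex_nontrivial_root_of_unity:
  fixes m p :: nat
  assumes "m > 0" and p: "Factorial_Ring.prime p" and dvd: "p dvd totient m"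
  shows "\<exists>u. [u ^ p = 1] (mod m) \<and> \<not> [u = 1] (mod m)"
proof -
  have "m > 1"
    using assms by (cases "m = 1") auto
  then interpret residues "int m" "residue_ring (int m)"
    by unfold_locales auto
  let ?R = "residue_ring (int m)" and ?U = "units_of (residue_ring (int m))"
  interpret U: group ?U by (rule units_group)
  have "order ?U = p ^ 1 * (totient m div p)"
    using dvd totient_eq by (simp add: order_def units_of_carrier)
  then obtain H where H: "subgroup H ?U" "card H = p"
    using sylow_thm[OF p U.is_group, of 1] finite_Units by (auto simp: units_of_carrier)
  interpret H: subgroup H ?U by fact
  interpret HG: group "?U\<lparr>carrier := H\<rparr>" by (rule H.subgroup_is_group[OF U.is_group])
  obtain x where x: "x \<in> H" "x \<noteq> \<one>\<^bsub>?U\<^esub>"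
    using H(2) prime_gt_1_nat[OF p] 
    by (metis card_1_singleton_iff H.one_closed is_singletonI' is_singleton_altdef empty_iff less_irrefl)
  have xU: "x \<in> Units ?R" using x by (metis H.mem_carrier units_of_carrier)
  have "x [^]\<^bsub>?U\<^esub> p = \<one>\<^bsub>?U\<^esub>"
    using HG.pow_order_eq_1[of x] x(1) H(2) by (simp add: order_def U.nat_pow_consistent[symmetric])
  then have one: "x [^]\<^bsub>?R\<^esub> p = 1"
    using xU by (simp add: units_of_pow units_of_one res_one_eq)
  have xb: "0 < x" "x < int m" using xU by (auto simp: res_units_eq)
  have "x ^ p mod int m = 1"
    using pow_cong[of x p] one xb by simp
  then have "[nat x ^ p = 1] (mod m)"
    using xb \<open>m > 1\<close> by (simp add: cong_int_iff[symmetric] cong_def)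
  moreover have "\<not> [nat x = 1] (mod m)"
    using x(2) xb \<open>m > 1\<close> by (auto simp: cong_def units_of_one res_one_eq nat_less_iff)
  ultimately show ?thesis by blast
qed

text \<open>Whether \<open>p\<close> divides \<open>totient n\<close> because \<open>p\<^sup>2\<close> divides \<open>n\<close> or because \<open>p\<close> divides the totient of the
cofactor decides which of the two non-cyclic groups exists.\<close>
lemma coprime_totient_if_cyclic_number:
  assumes "n > 0" "cyclic_number n"
  shows "coprime n (totient n)"
proof (rule ccontr)
  assume "\<not> coprime n (totient n)"
  then have "gcd n (totient n) \<noteq> 1"
    by (simp add: coprime_iff_gcd_eq_1)
  then obtain p where "Factorial_Ring.prime p" "p dvd gcd n (totient n)"
    using prime_factor_nat by blast
  then have p: "Factorial_Ring.prime p" "p dvd n" "p dvd totient n"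
    by auto
  define m where "m = n div p"
  have n: "n = p * m" and m: "m > 0"
    using p assms(1) by (auto simp: m_def)
  have p1: "p > 1" using p prime_gt_1_nat by blast
  show False
  proof (cases "p dvd m")
    case True
    have ord: "order (integer_mod_group k) = k" if "k > 0" for k
      using that by (simp add: order_def carrier_integer_mod_group)
    have "\<not> cyclic_group (integer_mod_group p \<times>\<times> integer_mod_group m)"
      by (rule DirProd_not_cyclic) (use True p1 m ord in auto)
    moreover have "order (integer_mod_group p \<times>\<times> integer_mod_group m) = n"
      using ord p1 m n by (simp add: order_def card_cartesian_product)
    moreover have "group (integer_mod_group p \<times>\<times> integer_mod_group m)"
      by (simp add: DirProd_group)
    ultimately show False
      using cyclic_number_imp_cyclic_group[OF assms(2,1)] by blast
  next
    case False
    then have "coprime p m" using p(1) prime_imp_coprime by blast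
    then have "totient n = (p - 1) * totient m"
      using p(1) by (simp add: n totient_mult_coprime totient_prime)
    moreover have "\<not> p dvd p - 1"
      using p1 by (auto dest: dvd_imp_le)
    ultimately have "p dvd totient m"
      using p prime_dvd_mult_iff by metis
    then obtain u where u: "[u ^ p = 1] (mod m)" "\<not> [u = 1] (mod m)"
      using ex_nontrivial_root_of_unity m p(1) by blast
    have "order (twisted_product m p u) = n"
      by (simp add: order_twisted_product n)
    then have "cyclic_group (twisted_product m p u)"
      using cyclic_number_imp_cyclic_group[OF assms(2,1) group_twisted_product[OF m _ u(1)]] p1 by simp
    moreover have "\<not> cyclic_group (twisted_product m p u)"
      by (rule twisted_product_not_cyclic[OF m _ u]) (use p1 in simp)
    ultimately show False by contradiction
  qed
qed

theorem theorem3p1: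
  fixes n :: nat
  assumes "n > 0"
  shows "((\<forall>G :: nat monoid. group G \<and> order G = n \<longrightarrow> G \<cong> integer_mod_group n)
            \<longleftrightarrow> gcd n (totient n) = 1)
       \<and> (gcd n (totient n) = 1 \<longrightarrow>
            (\<forall>G :: ('a, 'b) monoid_scheme. group G \<and> order G = n \<longrightarrow> G \<cong> integer_mod_group n))"
proof -
  have "(\<forall>G :: nat monoid. group G \<and> order G = n \<longrightarrow> G \<cong> integer_mod_group n) \<longleftrightarrow> cyclic_number n"
    unfolding cyclic_number_def
  proof (rule iff_allI)
    fix G :: "nat monoid"
    show "(group G \<and> order G = n \<longrightarrow> G \<cong> integer_mod_group n) \<longleftrightarrow>
      (group G \<and> order G = n \<longrightarrow> cyclic_group G)"
      using iso_integer_mod_group_iff_cyclic[of G n] assms by blast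
  qed
  also have "\<dots> \<longleftrightarrow> gcd n (totient n) = 1"
    unfolding coprime_iff_gcd_eq_1[symmetric]
    using cyclic_number_if_coprime_totient[OF assms] coprime_totient_if_cyclic_number[OF assms]
    by blast
  finally have nat_iff: "(\<forall>G :: nat monoid. group G \<and> order G = n \<longrightarrow> G \<cong> integer_mod_group n)
      \<longleftrightarrow> gcd n (totient n) = 1" .
  have any_type: "G \<cong> integer_mod_group n"
    if "gcd n (totient n) = 1" "group G" "order G = n" for G :: "('a, 'b) monoid_scheme"
  proof -
    have "cyclic_number n"
      using cyclic_number_if_coprime_totient[OF assms] that(1)
      unfolding coprime_iff_gcd_eq_1[symmetric] by blast
    then show ?thesis
      using cyclic_number_imp_cyclic_group[OF _ assms that(2,3)]
        iso_integer_mod_group_iff_cyclic[OF that(2,3) assms] by blast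
  qed
  have "\<forall>G :: ('a, 'b) monoid_scheme. group G \<and> order G = n \<longrightarrow> G \<cong> integer_mod_group n"
    if "gcd n (totient n) = 1"
  proof (intro allI impI, elim conjE)
    fix G :: "('a, 'b) monoid_scheme"
    assume "group G" "order G = n"
    with that show "G \<cong> integer_mod_group n" by (rule any_type)
  qed
  with nat_iff show ?thesis by (intro conjI impI)
qed

end
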